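(* Let $A$ and $B$ be separable $\mathrm{C}^*$-algebras with an embedding (injective $*$-homomorphism) $\iota: A\to B$. If $\iota$ is an existential embedding, then $\iota$ is sequentially split.
   Context: $A_\infty=\ell^\infty(\mathbb{N},A)/c_0(\mathbb{N},A)$; $A$ embeds canonically into $A_\infty$ as constant sequences. A $*$-homomorphism $\varphi:A\to B$ is sequentially split if there is a $*$-homomorphism $\psi:B\to A_\infty$ with $\psi\circ\varphi$ the canonical inclusion $A\hookrightarrow A_\infty$. An embedding $\iota:A\to B$ is existential if for every quantifier-free formula $\phi(\bar x,\bar y)$ (in tuples of variables $\bar x,\bar y$) in the language of $\mathrm{C}^*$-algebras, any $n\ge1$ and any tuple $\bar a$ from $A$, $$\inf\{\phi(\bar a,\bar x)\mid\bar x\in A_{\le n}\}=\inf\{\phi(\iota(\bar a),\bar y)\mid\bar y\in B_{\le n}\},$$ where $A_{\le n}$ denotes the closed ball of radius $n$ and $\bar x\in A_{\le n}$ means that $\bar x$ is a tuple of elements of that ball. A quantifier-free formula is an expression $f(\|P_1\|,\dots,\|P_k\|)$ with $f:\mathbb{R}^k\to\mathbb{R}$ continuous and $P_1,\dots,P_k$ noncommutative $*$-polynomials in the variables with complex coefficients and without constant term. *)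

theory Defs
  imports "HOL-Analysis.Analysis"
begin

section \<open>C*-algebras\<close>

text \<open>Algebras are not assumed to be unital, and the zero algebra is allowed.\<close>

class star_algebra = ring +
  fixes scaleC :: "complex \<Rightarrow> 'a \<Rightarrow> 'a" (infixr "*\<^sub>C" 75)
    and star :: "'a \<Rightarrow> 'a"
  assumes scaleC_add_right: "c *\<^sub>C (x + y) = c *\<^sub>C x + c *\<^sub>C y"
    and scaleC_add_left: "(c + d) *\<^sub>C x = c *\<^sub>C x + d *\<^sub>C x"
    and scaleC_scaleC: "c *\<^sub>C d *\<^sub>C x = (c * d) *\<^sub>C x"
    and scaleC_one: "1 *\<^sub>C x = x"
    and mult_scaleC_left: "(c *\<^sub>C x) * y = c *\<^sub>C (x * y)"
    and mult_scaleC_right: "x * (c *\<^sub>C y) = c *\<^sub>C (x * y)"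
    and star_add: "star (x + y) = star x + star y"
    and star_scaleC: "star (c *\<^sub>C x) = cnj c *\<^sub>C star x"
    and star_mult: "star (x * y) = star y * star x"
    and star_star: "star (star x) = x"

class cstar_algebra = star_algebra + real_normed_algebra + banach +
  assumes scaleR_eq_scaleC: "r *\<^sub>R x = complex_of_real r *\<^sub>C x"
    and norm_scaleC: "norm (c *\<^sub>C x) = cmod c * norm x"
    and cstar_identity: "norm (star x * x) = (norm x)\<^sup>2"

definition star_hom :: "('a::star_algebra \<Rightarrow> 'b::star_algebra) \<Rightarrow> bool" where
  "star_hom f \<longleftrightarrow>
    (\<forall>x y. f (x + y) = f x + f y) \<and>
    (\<forall>c x. f (c *\<^sub>C x) = c *\<^sub>C f x) \<and>
    (\<forall>x y. f (x * y) = f x * f y) \<and>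
    (\<forall>x. f (star x) = star (f x))"


section \<open>The sequence algebra\<close>

text \<open>
  The quotient of the bounded sequences by the null sequences. As a \<open>*\<close>-homomorphism
  between C*-algebras is a purely algebraic notion, only the \<open>*\<close>-algebra structure of the
  quotient is needed; its norm, the limit superior of the norms, is not introduced.
\<close>

definition seq_rel :: "(nat \<Rightarrow> 'a::cstar_algebra) \<Rightarrow> (nat \<Rightarrow> 'a) \<Rightarrow> bool" where
  "seq_rel a b \<longleftrightarrow> Bseq a \<and> Bseq b \<and> (\<lambda>k. a k - b k) \<longlonglongrightarrow> 0"

lemma star_minus: "star (- x) = - star (x::'a::star_algebra)"
proof -
  have "star (0::'a) + star 0 = star 0 + 0"
    by (metis star_add add.right_neutral)
  then have "star (0::'a) = 0" by (rule add_left_imp_eq)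
  then have "star x + star (- x) = 0" by (simp flip: star_add)
  then show ?thesis by (simp add: eq_neg_iff_add_eq_0 add.commute)
qed

lemma star_diff: "star (x - y) = star x - star (y::'a::star_algebra)"
  using star_add[of x "- y"] by (simp add: star_minus)

lemma scaleC_diff_right: "c *\<^sub>C (x - y) = c *\<^sub>C x - c *\<^sub>C (y::'a::star_algebra)"
  using scaleC_add_right[of c "x - y" y] by simp

lemma norm_star [simp]: "norm (star x) = norm (x::'a::cstar_algebra)"
proof -
  have le: "norm y \<le> norm (star y)" for y :: 'a
  proof (cases "norm y = 0")
    case False
    have "norm y * norm y \<le> norm (star y) * norm y"
      using norm_mult_ineq[of "star y" y] by (simp add: cstar_identity power2_eq_square)
    with False show ?thesis by (simp add: mult_le_cancel_right)
  qed simp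
  show ?thesis using le[of x] le[of "star x"] by (simp add: star_star)
qed

lemma Bseq_plus:
  fixes a b :: "nat \<Rightarrow> 'a::real_normed_vector"
  assumes "Bseq a" "Bseq b" shows "Bseq (\<lambda>k. a k + b k)"
proof -
  from assms obtain K L where "\<And>k. norm (a k) \<le> K" "\<And>k. norm (b k) \<le> L"
    by (auto simp: Bseq_def)
  then have "norm (a k + b k) \<le> K + L" for k
    by (meson norm_triangle_mono)
  then show ?thesis by (rule BseqI')
qed

lemma Bseq_times:
  fixes a b :: "nat \<Rightarrow> 'a::real_normed_algebra"
  assumes "Bseq a" "Bseq b" shows "Bseq (\<lambda>k. a k * b k)"
proof -
  from assms obtain K L where K: "\<And>k. norm (a k) \<le> K" and L: "\<And>k. norm (b k) \<le> L"
    by (auto simp: Bseq_def)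
  have "norm (a k * b k) \<le> K * L" for k
    using norm_mult_ineq[of "a k" "b k"] mult_mono[OF K[of k] L[of k]] K[of k]
    by (meson norm_ge_zero order_trans)
  then show ?thesis by (rule BseqI')
qed

lemma Bseq_scaleC: "Bseq a \<Longrightarrow> Bseq (\<lambda>k. c *\<^sub>C (a k :: 'a::cstar_algebra))"
proof -
  assume "Bseq a"
  then obtain K where "\<And>k. norm (a k) \<le> K" by (auto simp: Bseq_def)
  then show ?thesis
    by (intro BseqI'[where K = "cmod c * K"]) (simp add: norm_scaleC mult_left_mono)
qed

lemma Bseq_star: "Bseq a \<Longrightarrow> Bseq (\<lambda>k. star (a k :: 'a::cstar_algebra))"
  by (simp add: Bseq_def)

lemma tendsto_zero_scaleC:
  "a \<longlonglongrightarrow> 0 \<Longrightarrow> (\<lambda>k. c *\<^sub>C (a k :: 'a::cstar_algebra)) \<longlonglongrightarrow> 0"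
  by (subst tendsto_norm_zero_iff[symmetric])
    (simp add: norm_scaleC tendsto_mult_right_zero tendsto_norm_zero)

lemma tendsto_zero_star: "a \<longlonglongrightarrow> 0 \<Longrightarrow> (\<lambda>k. star (a k :: 'a::cstar_algebra)) \<longlonglongrightarrow> 0"
  by (subst tendsto_norm_zero_iff[symmetric]) (simp add: tendsto_norm_zero)

quotient_type (overloaded) 'a seq_algebra = "nat \<Rightarrow> 'a::cstar_algebra" / partial: seq_rel
proof (rule part_equivpI)
  show "\<exists>a::nat \<Rightarrow> 'a. seq_rel a a"
    by (rule exI[of _ "\<lambda>_. 0"]) (simp add: seq_rel_def)
  show "symp (seq_rel :: (nat \<Rightarrow> 'a) \<Rightarrow> _)"
  proof (rule sympI)
    fix a b :: "nat \<Rightarrow> 'a"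
    assume "seq_rel a b"
    then show "seq_rel b a"
      using tendsto_minus[of "\<lambda>k. a k - b k" 0 sequentially] by (simp add: seq_rel_def)
  qed
  show "transp (seq_rel :: (nat \<Rightarrow> 'a) \<Rightarrow> _)"
  proof (rule transpI)
    fix a b c :: "nat \<Rightarrow> 'a"
    assume "seq_rel a b" "seq_rel b c"
    then show "seq_rel a c"
      using tendsto_add[of "\<lambda>k. a k - b k" 0 sequentially "\<lambda>k. b k - c k" 0]
      by (simp add: seq_rel_def)
  qed
qed

instantiation seq_algebra :: (cstar_algebra) star_algebra
begin

lift_definition zero_seq_algebra :: "'a seq_algebra" is "\<lambda>_. 0"
  by (simp add: seq_rel_def)

lift_definition plus_seq_algebra :: "'a seq_algebra \<Rightarrow> 'a seq_algebra \<Rightarrow> 'a seq_algebra"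
  is "\<lambda>a b k. a k + b k"
  by (auto simp: seq_rel_def add_diff_add intro: Bseq_plus tendsto_add_zero)

lift_definition uminus_seq_algebra :: "'a seq_algebra \<Rightarrow> 'a seq_algebra" is "\<lambda>a k. - a k"
proof -
  fix a b :: "nat \<Rightarrow> 'a"
  assume "seq_rel a b"
  then show "seq_rel (\<lambda>k. - a k) (\<lambda>k. - b k)"
    using tendsto_minus[of "\<lambda>k. a k - b k" 0 sequentially]
    by (simp add: seq_rel_def Bseq_minus_iff)
qed

definition minus_seq_algebra :: "'a seq_algebra \<Rightarrow> 'a seq_algebra \<Rightarrow> 'a seq_algebra" where
  "minus_seq_algebra a b = a + - b"

lift_definition times_seq_algebra :: "'a seq_algebra \<Rightarrow> 'a seq_algebra \<Rightarrow> 'a seq_algebra"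
  is "\<lambda>a b k. a k * b k"
proof -
  fix a a' b b' :: "nat \<Rightarrow> 'a"
  assume *: "seq_rel a a'" "seq_rel b b'"
  have "(\<lambda>k. (a k - a' k) * b k) \<longlonglongrightarrow> 0" "(\<lambda>k. a' k * (b k - b' k)) \<longlonglongrightarrow> 0"
    using * unfolding seq_rel_def
    by (auto simp flip: tendsto_Zfun_iff
        intro: bounded_bilinear.Zfun_prod_Bfun[OF bounded_bilinear_mult]
          bounded_bilinear.Bfun_prod_Zfun[OF bounded_bilinear_mult] simp: tendsto_Zfun_iff)
  then have "(\<lambda>k. (a k - a' k) * b k + a' k * (b k - b' k)) \<longlonglongrightarrow> 0"
    by (rule tendsto_add_zero)
  with * show "seq_rel (\<lambda>k. a k * b k) (\<lambda>k. a' k * b' k)"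
    by (simp add: seq_rel_def Bseq_times algebra_simps)
qed

lift_definition scaleC_seq_algebra :: "complex \<Rightarrow> 'a seq_algebra \<Rightarrow> 'a seq_algebra"
  is "\<lambda>c a k. c *\<^sub>C a k"
  by (auto simp: seq_rel_def simp flip: scaleC_diff_right
      intro: Bseq_scaleC tendsto_zero_scaleC)

lift_definition star_seq_algebra :: "'a seq_algebra \<Rightarrow> 'a seq_algebra" is "\<lambda>a k. star (a k)"
  by (auto simp: seq_rel_def simp flip: star_diff intro: Bseq_star tendsto_zero_star)

instance
proof
  fix a b c :: "'a seq_algebra" and r s :: complex
  show "a + b + c = a + (b + c)"
    by transfer (auto simp: seq_rel_def add.assoc intro: Bseq_plus)
  show "a + b = b + a"
    by transfer (auto simp: seq_rel_def add.commute intro: Bseq_plus)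
  show "0 + a = a"
    by transfer (auto simp: seq_rel_def)
  show "- a + a = 0"
    by transfer (auto simp: seq_rel_def)
  show "a - b = a + - b"
    by (rule minus_seq_algebra_def)
  show "a * b * c = a * (b * c)"
    by transfer (auto simp: seq_rel_def mult.assoc intro: Bseq_times)
  show "(a + b) * c = a * c + b * c"
    by transfer (auto simp: seq_rel_def distrib_right intro!: Bseq_times Bseq_plus)
  show "a * (b + c) = a * b + a * c"
    by transfer (auto simp: seq_rel_def distrib_left intro!: Bseq_times Bseq_plus)
  show "r *\<^sub>C (a + b) = r *\<^sub>C a + r *\<^sub>C b"
    by transfer (auto simp: seq_rel_def scaleC_add_right intro!: Bseq_scaleC Bseq_plus)
  show "(r + s) *\<^sub>C a = r *\<^sub>C a + s *\<^sub>C a"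
    by transfer (auto simp: seq_rel_def scaleC_add_left intro!: Bseq_scaleC Bseq_plus)
  show "r *\<^sub>C s *\<^sub>C a = (r * s) *\<^sub>C a"
    by transfer (auto simp: seq_rel_def scaleC_scaleC intro!: Bseq_scaleC)
  show "1 *\<^sub>C a = a"
    by transfer (auto simp: seq_rel_def scaleC_one)
  show "(r *\<^sub>C a) * b = r *\<^sub>C (a * b)"
    by transfer (auto simp: seq_rel_def mult_scaleC_left intro!: Bseq_scaleC Bseq_times)
  show "a * (r *\<^sub>C b) = r *\<^sub>C (a * b)"
    by transfer (auto simp: seq_rel_def mult_scaleC_right intro!: Bseq_scaleC Bseq_times)
  show "star (a + b) = star a + star b"
    by transfer (auto simp: seq_rel_def star_add intro!: Bseq_star Bseq_plus)
  show "star (r *\<^sub>C a) = cnj r *\<^sub>C star a"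
    by transfer (auto simp: seq_rel_def star_scaleC intro!: Bseq_scaleC Bseq_star)
  show "star (a * b) = star b * star a"
    by transfer (auto simp: seq_rel_def star_mult intro!: Bseq_star Bseq_times)
  show "star (star a) = a"
    by transfer (auto simp: seq_rel_def star_star)
qed

end

lift_definition const_seq :: "'a::cstar_algebra \<Rightarrow> 'a seq_algebra" is "\<lambda>x _. x"
  by (simp add: seq_rel_def)

definition sequentially_split :: "('a::cstar_algebra \<Rightarrow> 'b::cstar_algebra) \<Rightarrow> bool" where
  "sequentially_split \<phi> \<longleftrightarrow> (\<exists>\<psi> :: 'b \<Rightarrow> 'a seq_algebra. star_hom \<psi> \<and> \<psi> \<circ> \<phi> = const_seq)"


section \<open>Quantifier-free formulas and existential embeddings\<close>

text \<open>
  Noncommutative \<open>*\<close>-polynomials are given by expressions. Since \<open>Var\<close> is the only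
  constructor for atoms, every expression expands to a complex linear combination of
  nonempty words in the variables and their adjoints, i.e. there is no constant term,
  and every such combination is obtained.
\<close>

datatype (poly_vars: 'v) star_poly =
    Var 'v
  | Add "'v star_poly" "'v star_poly"
  | Mult "'v star_poly" "'v star_poly"
  | Scale complex "'v star_poly"
  | Star "'v star_poly"

primrec poly_eval :: "('v \<Rightarrow> 'a::star_algebra) \<Rightarrow> 'v star_poly \<Rightarrow> 'a" where
  "poly_eval v (Var x) = v x"
| "poly_eval v (Add P Q) = poly_eval v P + poly_eval v Q"
| "poly_eval v (Mult P Q) = poly_eval v P * poly_eval v Q"
| "poly_eval v (Scale c P) = c *\<^sub>C poly_eval v P"
| "poly_eval v (Star P) = star (poly_eval v P)"

text \<open>
  \<open>QF f [P\<^sub>1, \<dots>, P\<^sub>k]\<close> stands for the formula \<open>f (\<parallel>P\<^sub>1\<parallel>, \<dots>, \<parallel>P\<^sub>k\<parallel>)\<close>. The space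
  \<^term>\<open>Euclidean_space k\<close> consists of the real sequences that vanish from index \<open>k\<close> on;
  values of \<open>f\<close> elsewhere are irrelevant.
\<close>

datatype 'v qf_formula = QF "(nat \<Rightarrow> real) \<Rightarrow> real" "'v star_poly list"

primrec wf_formula :: "'v qf_formula \<Rightarrow> bool" where
  "wf_formula (QF f Ps) \<longleftrightarrow> continuous_map (Euclidean_space (length Ps)) euclideanreal f"

primrec formula_vars :: "'v qf_formula \<Rightarrow> 'v set" where
  "formula_vars (QF f Ps) = (\<Union>P\<in>set Ps. poly_vars P)"

primrec formula_value :: "'v qf_formula \<Rightarrow> ('v \<Rightarrow> 'a::cstar_algebra) \<Rightarrow> real" where
  "formula_value (QF f Ps) v =
    f (\<lambda>i. if i < length Ps then norm (poly_eval v (Ps ! i)) else 0)"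

text \<open>
  A formula in a tuple of \<open>k\<close> variables (for parameters) and a tuple of \<open>m\<close> variables
  (over which the infimum is taken): the former are \<open>Inl 0, \<dots>, Inl (k - 1)\<close>, the latter
  \<open>Inr 0, \<dots>, Inr (m - 1)\<close>.
\<close>

definition qf_formulas :: "nat \<Rightarrow> nat \<Rightarrow> (nat + nat) qf_formula set" where
  "qf_formulas k m = {\<phi>. wf_formula \<phi> \<and> formula_vars \<phi> \<subseteq> Inl ` {..<k} \<union> Inr ` {..<m}}"

definition interp :: "(nat + nat) qf_formula \<Rightarrow> 'a::cstar_algebra list \<Rightarrow> 'a list \<Rightarrow> real" where
  "interp \<phi> as xs = formula_value \<phi> (case_sum (nth as) (nth xs))"

definition ball_tuples :: "nat \<Rightarrow> real \<Rightarrow> 'a::cstar_algebra list set" where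
  "ball_tuples m r = {xs. length xs = m \<and> set xs \<subseteq> cball 0 r}"

definition existential :: "('a::cstar_algebra \<Rightarrow> 'b::cstar_algebra) \<Rightarrow> bool" where
  "existential \<iota> \<longleftrightarrow>
    (\<forall>as m. \<forall>\<phi> \<in> qf_formulas (length as) m. \<forall>n\<ge>1.
      (INF xs \<in> ball_tuples m (real n). interp \<phi> as xs) =
      (INF ys \<in> ball_tuples m (real n). interp \<phi> (map \<iota> as) ys))"

end

theory Submission
  imports Defs
begin

text \<open>
  Existentiality allows finitely many elements of \<open>B\<close> to be copied into \<open>A\<close> approximately: given
  \<open>a\<^sub>0, \<dots>\<close> in \<open>A\<close>, \<open>b\<^sub>0, \<dots>\<close> in \<open>B\<close>, finitely many \<open>*\<close>-polynomials \<open>P\<close> and \<open>\<epsilon> > 0\<close>, there are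
  \<open>x\<^sub>0, \<dots>\<close> in \<open>A\<close> with \<open>\<parallel>P(a, x)\<parallel> \<le> \<parallel>P(\<iota> a, b)\<parallel> + \<epsilon>\<close> for all of them. Indeed the formula
  that adds up the excesses \<open>max 0 (\<parallel>P(a, x)\<parallel> - \<parallel>P(\<iota> a, b)\<parallel>)\<close> is nonnegative and vanishes at
  the \<open>b\<close>'s, so its infimum over a ball of \<open>B\<close> that contains them is \<open>0\<close>, and the same holds over
  the ball of \<open>A\<close>. This is lemma \<open>existential_approx\<close>.

  Let now \<open>(a\<^sub>i)\<close>, \<open>(b\<^sub>i)\<close>, \<open>(c\<^sub>i)\<close> be dense sequences in \<open>A\<close>, \<open>B\<close> and the complex numbers. At
  stage \<open>k\<close> take copies \<open>x\<^sup>k\<^sub>i\<close> of the \<open>b\<^sub>i\<close>, with \<open>\<epsilon> = 1/(k+1)\<close>, for the polynomials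
  \<open>x\<^sub>i\<close>, \<open>x\<^sub>i + x\<^sub>j - x\<^sub>l\<close>, \<open>x\<^sub>i x\<^sub>j - x\<^sub>l\<close>, \<open>x\<^sub>i* - x\<^sub>l\<close>, \<open>c\<^sub>j x\<^sub>i - x\<^sub>l\<close> and \<open>x\<^sub>i - a\<^sub>j\<close> with indices at most
  \<open>k\<close>. An arbitrary \<open>y\<close> in \<open>B\<close> has approximants \<open>b\<^bsub>p(y,k)\<^esub> \<longlonglongrightarrow> y\<close> with \<open>p(y,k) \<le> k\<close>, by lemma
  \<open>dense_sequence\<close>, and \<open>\<psi>(y)\<close> is the class of the sequence of the \<open>x\<^sup>k\<close> with index \<open>p(y,k)\<close>.
  The relations between the approximants hold in the limit \<open>k \<rightarrow> \<infinity>\<close> and are inherited by the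
  copies; for instance
  \<open>b\<^bsub>p(y,k)\<^esub> + b\<^bsub>p(z,k)\<^esub> - b\<^bsub>p(y+z,k)\<^esub>\<close> tends to \<open>0\<close>, hence so does the same combination of the
  copies, which says \<open>\<psi>(y) + \<psi>(z) = \<psi>(y+z)\<close>. The polynomials \<open>x\<^sub>i - a\<^sub>j\<close> give \<open>\<psi>(\<iota>(a)) = a\<close>,
  because \<open>\<iota>\<close> is isometric.

  Letting the index depend on the stage defines \<open>\<psi>\<close> on all of \<open>B\<close> at once, in place of an
  extension by continuity from a dense subalgebra.
\<close>

lemma scaleC_minus_one: "(-1) *\<^sub>C x = - (x::'a::cstar_algebra)"
  using scaleR_eq_scaleC[of "-1" x] by simp

lemma bounded_bilinear_scaleC: "bounded_bilinear (\<lambda>c (x::'a::cstar_algebra). c *\<^sub>C x)"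
proof
  show "\<exists>K. \<forall>c (x::'a). norm (c *\<^sub>C x) \<le> norm c * norm x * K"
    by (rule exI[of _ 1]) (simp add: norm_scaleC)
qed (simp_all add: scaleC_add_left scaleC_add_right scaleR_eq_scaleC scaleC_scaleC scaleR_conv_of_real mult.commute)

lemma poly_eval_cong:
  "(\<And>x. x \<in> poly_vars P \<Longrightarrow> v x = w x) \<Longrightarrow> poly_eval v P = poly_eval w P"
  by (induction P) auto

lemma star_hom_diff:
  assumes "star_hom f" shows "f (x - y) = f x - f y"
  using assms unfolding star_hom_def by (metis add_diff_cancel diff_add_cancel)

text \<open>
  The bound \<^term>\<open>p x k \<le> k\<close> is the point: at stage \<open>k\<close> only finitely many members of the
  sequence are needed, for all \<open>x\<close> simultaneously. The nearest of the members up to \<open>k\<close> will do.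
\<close>

lemma dense_sequence:
  assumes "separable_space (euclidean :: 'a::metric_space topology)"
  obtains d :: "nat \<Rightarrow> 'a::metric_space" and p :: "'a::metric_space \<Rightarrow> nat \<Rightarrow> nat"
  where "\<And>x k. p x k \<le> k" and "\<And>x. (\<lambda>k. d (p x k)) \<longlonglongrightarrow> x"
proof -
  obtain C :: "'a set" where C: "countable C" "closure C = UNIV"
    using assms unfolding separable_space_def by auto
  then have "C \<noteq> {}" by auto
  define d where "d = from_nat_into C"
  define p where "p = (\<lambda>x k. arg_min_on (\<lambda>i. dist (d i) x) {..k})"
  have p: "p x k \<le> k" and min: "i \<le> k \<Longrightarrow> dist (d (p x k)) x \<le> dist (d i) x" for x k i
    using arg_min_if_finite(1)[of "{..k}" "\<lambda>i. dist (d i) x"]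
      arg_min_least[of "{..k}" i "\<lambda>i. dist (d i) x"]
    by (auto simp: p_def)
  have "(\<lambda>k. d (p x k)) \<longlonglongrightarrow> x" for x
  proof (rule metric_LIMSEQ_I)
    fix e :: real assume "0 < e"
    moreover have "x \<in> closure C" using C by simp
    ultimately obtain y where "y \<in> C" "dist y x < e"
      unfolding closure_approachable by blast
    then obtain N where "dist (d N) x < e"
      using from_nat_into_surj[OF \<open>countable C\<close>] unfolding d_def by blast
    then show "\<exists>N. \<forall>k\<ge>N. dist (d (p x k)) x < e"
      using min by (meson le_less_trans)
  qed
  with p show ?thesis by (rule that)
qed

lemma continuous_map_Euclidean_space_component:
  "continuous_map (Euclidean_space n) euclideanreal (\<lambda>t. t i)"
  unfolding Euclidean_space_def
  by (intro continuous_map_from_subtopology continuous_map_product_projection UNIV_I)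

lemma ball_tuples_0: "0 \<le> r \<Longrightarrow> ball_tuples 0 r = {[]}"
  by (auto simp: ball_tuples_def)

text \<open>
  The formula \<open>\<parallel>a\<parallel>\<close> has only a parameter. With no variables to range over, both infima are
  taken over the empty tuple alone.
\<close>

lemma existential_norm:
  assumes "existential \<iota>" shows "norm (\<iota> x) = norm x"
proof -
  let ?\<phi> = "QF (\<lambda>t. t 0) [Var (Inl 0)]"
  have "?\<phi> \<in> qf_formulas (length [x]) 0"
    by (simp add: qf_formulas_def continuous_map_Euclidean_space_component)
  then have "(INF xs \<in> ball_tuples 0 (real 1). interp ?\<phi> [x] xs) =
      (INF ys \<in> ball_tuples 0 (real 1). interp ?\<phi> (map \<iota> [x]) ys)"
    using assms unfolding existential_def by blast
  then show ?thesis by (simp add: interp_def ball_tuples_0)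
qed

text \<open>
  Parameters and variables are given by infinite sequences, of which the finitely many
  polynomials see only an initial segment; this spares the user of the lemma a bound on the
  indices.
\<close>

lemma existential_approx:
  fixes a :: "nat \<Rightarrow> 'a::cstar_algebra" and b :: "nat \<Rightarrow> 'b::cstar_algebra"
  assumes "existential \<iota>" and "finite T" and "0 < e"
  shows "\<exists>x. \<forall>P\<in>T. norm (poly_eval (case_sum a x) P) \<le>
      norm (poly_eval (case_sum (\<lambda>i. \<iota> (a i)) b) P) + e"
proof -
  let ?w = "case_sum (\<lambda>i. \<iota> (a i)) b"
  obtain Ps where Ps: "set Ps = T" using \<open>finite T\<close> finite_list by blast
  have finv: "finite (poly_vars P)" for P :: "(nat + nat) star_poly" by (induction P) auto
  \<comment> \<open>a common strict bound \<open>N\<close> for the indices of parameters and variables in \<open>T\<close>\<close>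
  define V where "V = (\<Union>P\<in>T. poly_vars P)"
  have "finite (case_sum id id ` V)"
    using finv \<open>finite T\<close> by (auto simp: V_def)
  then obtain N :: nat where N: "\<forall>i\<in>case_sum id id ` V. i < N"
    using finite_nat_set_iff_bounded by metis
  have "z \<in> Inl ` {..<N} \<union> Inr ` {..<N}" if "z \<in> V" for z
    using bspec[OF N imageI[OF that]] by (cases z) auto
  then have vars: "z \<in> Inl ` {..<N} \<union> Inr ` {..<N}" if "P \<in> T" "z \<in> poly_vars P" for P z
    using that unfolding V_def by blast
  define g where "g = (\<lambda>t::nat \<Rightarrow> real.
    \<Sum>i<length Ps. max 0 (t i - norm (poly_eval ?w (Ps ! i))))"
  define \<phi> where "\<phi> = QF g Ps"
  have "continuous_map (Euclidean_space (length Ps)) euclideanreal g"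
    unfolding g_def
    by (intro continuous_map_sum continuous_map_real_max continuous_map_diff
        continuous_map_Euclidean_space_component) auto
  then have \<phi>: "\<phi> \<in> qf_formulas (length (map a [0..<N])) N"
    using vars Ps unfolding qf_formulas_def \<phi>_def by auto
  have "norm (b i) \<le> (\<Sum>j<N. norm (b j))" if "i < N" for i
    using that by (intro member_le_sum) auto
  then obtain r where r: "\<And>i. i < N \<Longrightarrow> norm (b i) \<le> r" by blast
  obtain n :: nat where n: "1 \<le> n" "r \<le> real n"
    by (metis nat_le_linear of_nat_mono order_trans real_arch_simple)
  define bs where "bs = map b [0..<N]"
  have bs: "bs \<in> ball_tuples N (real n)"
    using order_trans[OF r n(2)] by (auto simp: ball_tuples_def bs_def)
  have nonneg: "0 \<le> g t" for t
    by (simp add: g_def sum_nonneg)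
  have "poly_eval (case_sum (nth (map \<iota> (map a [0..<N]))) (nth bs)) P = poly_eval ?w P"
    if "P \<in> T" for P
    by (rule poly_eval_cong) (use vars that in \<open>force simp: bs_def\<close>)
  then have "interp \<phi> (map \<iota> (map a [0..<N])) bs = 0"
    using Ps by (auto simp: interp_def \<phi>_def g_def intro!: sum.neutral)
  moreover have "bdd_below (interp \<phi> (map \<iota> (map a [0..<N])) ` ball_tuples N (real n))"
    by (rule bdd_below.I2[of _ 0]) (simp add: interp_def \<phi>_def nonneg)
  ultimately have "(INF ys \<in> ball_tuples N (real n). interp \<phi> (map \<iota> (map a [0..<N])) ys) \<le> 0"
    using cINF_lower[OF _ bs] by fastforce
  then have "(INF xs \<in> ball_tuples N (real n). interp \<phi> (map a [0..<N]) xs) < e"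
    using \<open>existential \<iota>\<close> \<phi> n(1) \<open>0 < e\<close> unfolding existential_def by (metis le_less_trans)
  moreover have "replicate N 0 \<in> (ball_tuples N (real n) :: 'a list set)"
    by (auto simp: ball_tuples_def)
  moreover have "bdd_below (interp \<phi> (map a [0..<N]) ` ball_tuples N (real n))"
    by (rule bdd_below.I2[of _ 0]) (simp add: interp_def \<phi>_def nonneg)
  ultimately obtain xs where xs: "interp \<phi> (map a [0..<N]) xs < e"
    using cINF_less_iff by (metis empty_iff)
  have "norm (poly_eval (case_sum a (nth xs)) P) \<le> norm (poly_eval ?w P) + e" if "P \<in> T" for P
  proof -
    let ?u = "case_sum (nth (map a [0..<N])) (nth xs)"
    obtain i where i: "i < length Ps" "Ps ! i = P"
      using \<open>P \<in> T\<close> Ps by (metis in_set_conv_nth)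
    have "norm (poly_eval ?u P) - norm (poly_eval ?w P)
        \<le> max 0 (norm (poly_eval ?u (Ps ! i)) - norm (poly_eval ?w (Ps ! i)))"
      using i by simp
    also have "\<dots> \<le> (\<Sum>i<length Ps. max 0 (norm (poly_eval ?u (Ps ! i)) - norm (poly_eval ?w (Ps ! i))))"
      by (rule member_le_sum) (use i in auto)
    also have "\<dots> < e"
      using xs by (simp add: interp_def \<phi>_def g_def)
    also have "poly_eval ?u P = poly_eval (case_sum a (nth xs)) P"
      by (rule poly_eval_cong) (use vars that in force)
    finally show ?thesis by simp
  qed
  then show ?thesis by blast
qed

text \<open>
  The form in which asymptotic relations pass from the approximants in \<open>B\<close>, as \<open>g\<close>, to their
  copies in \<open>A\<close>, as \<open>f\<close>.
\<close>

lemma tendsto_zero_bound: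
  fixes f :: "nat \<Rightarrow> 'a::real_normed_vector" and g :: "nat \<Rightarrow> 'b::real_normed_vector"
  assumes "\<And>k. norm (f k) \<le> norm (g k) + inverse (real (Suc k))" and "g \<longlonglongrightarrow> 0"
  shows "f \<longlonglongrightarrow> 0"
proof (rule Lim_null_comparison[of _ "\<lambda>k. norm (g k) + inverse (real (Suc k))"])
  show "(\<lambda>k. norm (g k) + inverse (real (Suc k))) \<longlonglongrightarrow> 0"
    using tendsto_add[OF tendsto_norm_zero[OF assms(2)] LIMSEQ_inverse_real_of_nat] by simp
qed (use assms(1) in simp)

theorem theorem4p19:
  fixes \<iota> :: "'a::cstar_algebra \<Rightarrow> 'b::cstar_algebra"
  assumes "separable_space (euclidean :: 'a topology)"
    and "separable_space (euclidean :: 'b topology)"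
    and "star_hom \<iota>" and "inj \<iota>"
    and "existential \<iota>"
  shows "sequentially_split \<iota>"
proof -
  obtain a :: "nat \<Rightarrow> 'a" and q where q: "\<And>x k. q x k \<le> k" "\<And>x. (\<lambda>k. a (q x k)) \<longlonglongrightarrow> x"
    by (rule dense_sequence[OF assms(1)]) (rule that)
  obtain b :: "nat \<Rightarrow> 'b" and p where p: "\<And>y k. p y k \<le> k" "\<And>y. (\<lambda>k. b (p y k)) \<longlonglongrightarrow> y"
    by (rule dense_sequence[OF assms(2)]) (rule that)
  obtain D :: "complex set" where "countable D" "UNIV \<subseteq> closure D"
    by (rule separable[of UNIV])
  then have sep: "separable_space (euclidean :: complex topology)"
    unfolding separable_space_def by (intro exI[of _ D]) auto
  obtain c :: "nat \<Rightarrow> complex" and r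
    where r: "\<And>z k. r z k \<le> k" "\<And>z. (\<lambda>k. c (r z k)) \<longlonglongrightarrow> z"
    by (rule dense_sequence[OF sep]) (rule that)
  define sub :: "(nat + nat) star_poly \<Rightarrow> _" where "sub P Q = Add P (Scale (-1) Q)" for P Q
  define X where "X i = Var (Inr i :: nat + nat)" for i
  text \<open>
    The index \<open>j\<close> serves for a variable, for a scalar and for a parameter alike: one family
    with three indices then covers all the relations, and those that involve fewer indices
    are used below with the others set to \<open>0\<close>.
  \<close>
  define R where "R i j l =
    {X i, sub (Add (X i) (X j)) (X l), sub (Mult (X i) (X j)) (X l),
     sub (Star (X i)) (X l), sub (Scale (c j) (X i)) (X l), sub (X i) (Var (Inl j))}" for i j l
  define T where "T k = (\<Union>i\<le>k. \<Union>j\<le>k. \<Union>l\<le>k. R i j l)" for k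
  let ?w = "case_sum (\<lambda>i. \<iota> (a i)) b"
  have "\<forall>k. \<exists>x. \<forall>P\<in>T k. norm (poly_eval (case_sum a x) P)
      \<le> norm (poly_eval ?w P) + inverse (real (Suc k))"
    by (intro allI existential_approx[OF assms(5)]) (auto simp: T_def R_def)
  then obtain x where x: "\<And>k P. P \<in> T k \<Longrightarrow>
      norm (poly_eval (case_sum a (x k)) P) \<le> norm (poly_eval ?w P) + inverse (real (Suc k))"
    by metis
  define s where "s y k = x k (p y k)" for y k
  have mem: "R i j l \<subseteq> T k" if "i \<le> k" "j \<le> k" "l \<le> k" for i j l k
    using that unfolding T_def by blast
  note ev = R_def sub_def X_def scaleC_minus_one
  have Bs: "Bseq (s y)" for y
  proof -
    have "Bseq (\<lambda>k. norm (b (p y k)) + inverse (real (Suc k)))"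
      by (rule convergent_imp_Bseq[OF convergentI[OF tendsto_add[OF tendsto_norm[OF p(2)]
            LIMSEQ_inverse_real_of_nat]]])
    moreover have "norm (s y k) \<le> norm (norm (b (p y k)) + inverse (real (Suc k)))" for k
      using x[of "X (p y k)" k] mem[of "p y k" k 0 0] p(1)[of y k] by (simp add: ev s_def)
    ultimately show ?thesis by (intro Bseq_eventually_mono[of "s y"] always_eventually) auto
  qed
  have add: "(\<lambda>k. s y k + s z k - s (y + z) k) \<longlonglongrightarrow> 0" for y z
  proof (rule tendsto_zero_bound)
    show "norm (s y k + s z k - s (y + z) k)
        \<le> norm (b (p y k) + b (p z k) - b (p (y + z) k)) + inverse (real (Suc k))" for k
      using x[of "sub (Add (X (p y k)) (X (p z k))) (X (p (y + z) k))" k]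
        mem[of "p y k" k "p z k" "p (y + z) k"] p(1) by (simp add: ev s_def)
    show "(\<lambda>k. b (p y k) + b (p z k) - b (p (y + z) k)) \<longlonglongrightarrow> 0"
      using tendsto_diff[OF tendsto_add[OF p(2)[of y] p(2)[of z]] p(2)[of "y + z"]] by simp
  qed
  have mult: "(\<lambda>k. s y k * s z k - s (y * z) k) \<longlonglongrightarrow> 0" for y z
  proof (rule tendsto_zero_bound)
    show "norm (s y k * s z k - s (y * z) k)
        \<le> norm (b (p y k) * b (p z k) - b (p (y * z) k)) + inverse (real (Suc k))" for k
      using x[of "sub (Mult (X (p y k)) (X (p z k))) (X (p (y * z) k))" k]
        mem[of "p y k" k "p z k" "p (y * z) k"] p(1) by (simp add: ev s_def)
    show "(\<lambda>k. b (p y k) * b (p z k) - b (p (y * z) k)) \<longlonglongrightarrow> 0"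
      using tendsto_diff[OF tendsto_mult[OF p(2)[of y] p(2)[of z]] p(2)[of "y * z"]] by simp
  qed
  have star: "(\<lambda>k. star (s y k) - s (star y) k) \<longlonglongrightarrow> 0" for y
  proof (rule tendsto_zero_bound)
    show "norm (star (s y k) - s (star y) k)
        \<le> norm (star (b (p y k)) - b (p (star y) k)) + inverse (real (Suc k))" for k
      using x[of "sub (Star (X (p y k))) (X (p (star y) k))" k]
        mem[of "p y k" k 0 "p (star y) k"] p(1) by (simp add: ev s_def)
    have "(\<lambda>k. star (b (p y k) - y)) \<longlonglongrightarrow> 0"
      using p(2)[of y] by (intro tendsto_zero_star) (simp add: LIM_zero)
    then show "(\<lambda>k. star (b (p y k)) - b (p (star y) k)) \<longlonglongrightarrow> 0"
      using tendsto_diff[OF _ LIM_zero[OF p(2)[of "star y"]]] by (fastforce simp: star_diff)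
  qed
  \<comment> \<open>Only the scalars \<open>c\<^sub>j\<close> occur in \<open>R\<close>: a general \<open>z\<close> is replaced by approximants as well,
    at the cost of an error that vanishes because \<open>s y\<close> is bounded.\<close>
  have scale: "(\<lambda>k. z *\<^sub>C s y k - s (z *\<^sub>C y) k) \<longlonglongrightarrow> 0" for z y
  proof -
    have "(\<lambda>k. c (r z k) *\<^sub>C s y k - s (z *\<^sub>C y) k) \<longlonglongrightarrow> 0"
    proof (rule tendsto_zero_bound)
      show "norm (c (r z k) *\<^sub>C s y k - s (z *\<^sub>C y) k)
          \<le> norm (c (r z k) *\<^sub>C b (p y k) - b (p (z *\<^sub>C y) k)) + inverse (real (Suc k))" for k
        using x[of "sub (Scale (c (r z k)) (X (p y k))) (X (p (z *\<^sub>C y) k))" k]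
          mem[of "p y k" k "r z k" "p (z *\<^sub>C y) k"] p(1) r(1) by (simp add: ev s_def)
      show "(\<lambda>k. c (r z k) *\<^sub>C b (p y k) - b (p (z *\<^sub>C y) k)) \<longlonglongrightarrow> 0"
        using tendsto_diff[OF bounded_bilinear.tendsto[OF bounded_bilinear_scaleC r(2)[of z] p(2)[of y]]
            p(2)[of "z *\<^sub>C y"]] by simp
    qed
    moreover have "(\<lambda>k. (c (r z k) - z) *\<^sub>C s y k) \<longlonglongrightarrow> 0"
      using bounded_bilinear.Zfun_prod_Bfun[OF bounded_bilinear_scaleC _ Bs] r(2)[of z]
      by (simp add: tendsto_Zfun_iff)
    ultimately have "(\<lambda>k. (c (r z k) *\<^sub>C s y k - s (z *\<^sub>C y) k) - (c (r z k) - z) *\<^sub>C s y k) \<longlonglongrightarrow> 0"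
      using tendsto_diff by fastforce
    then show ?thesis by (simp add: bounded_bilinear.diff_left[OF bounded_bilinear_scaleC])
  qed
  have ext: "(\<lambda>k. s (\<iota> u) k - u) \<longlonglongrightarrow> 0" for u
  proof -
    have "(\<lambda>k. s (\<iota> u) k - a (q u k)) \<longlonglongrightarrow> 0"
    proof (rule tendsto_zero_bound)
      show "norm (s (\<iota> u) k - a (q u k))
          \<le> norm (b (p (\<iota> u) k) - \<iota> (a (q u k))) + inverse (real (Suc k))" for k
        using x[of "sub (X (p (\<iota> u) k)) (Var (Inl (q u k)))" k]
          mem[of "p (\<iota> u) k" k "q u k" 0] p(1) q(1) by (simp add: ev s_def)
      have "(\<lambda>k. norm (\<iota> (a (q u k) - u))) \<longlonglongrightarrow> 0"
        unfolding existential_norm[OF assms(5)] by (rule tendsto_norm_zero[OF LIM_zero[OF q(2)]])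
      then have "(\<lambda>k. \<iota> (a (q u k))) \<longlonglongrightarrow> \<iota> u"
        unfolding star_hom_diff[OF assms(3)] by (rule LIM_zero_cancel[OF tendsto_norm_zero_cancel])
      then show "(\<lambda>k. b (p (\<iota> u) k) - \<iota> (a (q u k))) \<longlonglongrightarrow> 0"
        using tendsto_diff[OF p(2)[of "\<iota> u"]] by fastforce
    qed
    from tendsto_add[OF this LIM_zero[OF q(2)[of u]]] show ?thesis by simp
  qed
  define \<psi> where "\<psi> y = abs_seq_algebra (s y)" for y
  have rel: "seq_rel (s y) (s y)" for y using Bs by (simp add: seq_rel_def)
  have eq: "abs_seq_algebra u = \<psi> y" if "Bseq u" "(\<lambda>k. u k - s y k) \<longlonglongrightarrow> 0" for u y
    unfolding \<psi>_def using that Bs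
    by (intro Quotient3_rel_abs[OF Quotient3_seq_algebra]) (simp add: seq_rel_def)
  have "\<psi> (\<iota> u) = const_seq u" for u
    using tendsto_minus[OF ext[of u]]
    by (subst eq[symmetric, where u = "\<lambda>_. u"]) (simp_all add: const_seq.abs_eq const_seq_def)
  moreover have "star_hom \<psi>"
    unfolding star_hom_def
  proof (intro conjI allI)
    fix y z and t :: complex
    show "\<psi> (y + z) = \<psi> y + \<psi> z"
      using eq[OF Bseq_plus[OF Bs Bs] add] plus_seq_algebra.abs_eq[OF rel rel] by (simp add: \<psi>_def)
    show "\<psi> (y * z) = \<psi> y * \<psi> z"
      using eq[OF Bseq_times[OF Bs Bs] mult] times_seq_algebra.abs_eq[OF rel rel] by (simp add: \<psi>_def)
    show "\<psi> (star y) = star (\<psi> y)"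
      using eq[OF Bseq_star[OF Bs] star] star_seq_algebra.abs_eq[OF rel] by (simp add: \<psi>_def)
    show "\<psi> (t *\<^sub>C y) = t *\<^sub>C \<psi> y"
      using eq[OF Bseq_scaleC[OF Bs] scale] scaleC_seq_algebra.abs_eq[OF rel] by (simp add: \<psi>_def)
  qed
  ultimately show ?thesis unfolding sequentially_split_def by (auto simp: fun_eq_iff)
qed

end
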